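(* Consider the variational problem $$\max_{p(x_1)p(x_2|x_1)}\ \sum_{x_1}p(x_1)U(x_1)-\alpha\Big(\sum_{x_1}p(x_1)\log\frac{p(x_1)}{p_0(x_1)}-c_1\Big)+\sum_{x_1,x_2}p(x_1)p(x_2|x_1)U(x_2|x_1)-\beta\Big(\sum_{x_1,x_2}p(x_1)p(x_2|x_1)\log\frac{p(x_2|x_1)}{p_0(x_2|x_1)}-c_2\Big),$$ with $\alpha$ and $\beta$ as Lagrange multipliers. Up to constants, it can be rewritten as the nested problem $$\max_{p(x_1)p(x_2|x_1)}\ \sum_{x_1}p(x_1)\Bigg[U(x_1)-\alpha\log\frac{p(x_1)}{p_0(x_1)}+\sum_{x_2}p(x_2|x_1)\bigg[U(x_2|x_1)-\beta\log\frac{p(x_2|x_1)}{p_0(x_2|x_1)}\bigg]\Bigg].$$ The inner variational problem $$\max_{p(x_2|x_1)}\ \sum_{x_2}p(x_2|x_1)\Big[-\beta\log\frac{p(x_2|x_1)}{p_0(x_2|x_1)}+U(x_2|x_1)\Big]$$ has the solution $$p(x_2|x_1)=\frac{1}{Z_2}\,p_0(x_2|x_1)\exp\Big(\tfrac1\beta U(x_2|x_1)\Big),\qquad Z_2=\sum_{x_2}p_0(x_2|x_1)\exp\Big(\tfrac1\beta U(x_2|x_1)\Big),$$ where the normalization constant $Z_2$ depends on $x_1$. The outer variational problem $$\max_{p(x_1)}\ \sum_{x_1}p(x_1)\Big[-\alpha\log\frac{p(x_1)}{p_0(x_1)}+U(x_1)+\beta\log Z_2\Big]$$ has the solution $$p(x_1)=\frac{1}{Z_1}\,p_0(x_1)\exp\Big(\tfrac1\alpha\big(U(x_1)+\beta\log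 Z_2\big)\Big),\qquad Z_1=\sum_{x_1}p_0(x_1)\exp\Big(\tfrac1\alpha\big(U(x_1)+\beta\log Z_2\big)\Big).$$
   Context: A decision-maker first emits an action symbol $x_1$ with default probability $p_0(x_1)$ and then expects an input signal $x_2$ with default probability $p_0(x_2|x_1)$. Real-valued utilities $U(x_1)$ for the first symbol and $U(x_2|x_1)$ for the second symbol are imposed on it. The unknowns are the adjusted action probability $p(x_1)$ and the adjusted conditional expectation $p(x_2|x_1)$, both probability distributions. The constants $c_1$ and $c_2$ are the boundedness constraints on the relative entropies of $p(x_1)$ with respect to $p_0(x_1)$ and of $p(x_2|x_1)$ with respect to $p_0(x_2|x_1)$, and $\alpha$, $\beta$ are the associated Lagrange multipliers. Sums run over all values of $x_1$ and $x_2$.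
   Formalization: The multipliers are taken positive where maximality is claimed (β > 0 for the inner problem, α > 0 and β ≠ 0 for the outer one): for a negative multiplier the stated formula gives a minimizer, and for zero 1/α or 1/β is undefined. *)

theory Defs
  imports "HOL-Probability.Probability_Mass_Function"
begin

text \<open>
  The symbols \<open>x\<^sub>1\<close> and \<open>x\<^sub>2\<close> range over finite types. \<open>p0\<close>, \<open>q0 x1\<close> are the defaults
  \<open>p\<^sub>0(x\<^sub>1)\<close>, \<open>p\<^sub>0(x\<^sub>2|x\<^sub>1)\<close>; \<open>p\<close>, \<open>q x1\<close> are the unknowns \<open>p(x\<^sub>1)\<close>, \<open>p(x\<^sub>2|x\<^sub>1)\<close>;
  \<open>U1 x1\<close>, \<open>U2 x1 x2\<close> are the utilities \<open>U(x\<^sub>1)\<close>, \<open>U(x\<^sub>2|x\<^sub>1)\<close>.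

  A default may vanish somewhere. The usual conventions \<open>0 log 0 = 0 log (0/0) = 0\<close> hold
  here automatically. The convention \<open>p log (p/0) = \<infinity>\<close> for \<open>p > 0\<close> does not (\<open>ln (p/0) = 0\<close> in HOL):
  it is rendered by admitting only distributions dominated by the default, i.e. those
  with finite relative entropy. For the pair problem the conditional relative entropy is
  weighted by \<open>p(x\<^sub>1)\<close>, so the conditional is unrestricted where \<open>p(x\<^sub>1) = 0\<close>.
\<close>

definition dominated :: "'a pmf \<Rightarrow> 'a pmf \<Rightarrow> bool" where
  "dominated p0 p \<longleftrightarrow> set_pmf p \<subseteq> set_pmf p0"

definition dominated_pair ::
  "'a pmf \<Rightarrow> ('a \<Rightarrow> 'b pmf) \<Rightarrow> 'a pmf \<times> ('a \<Rightarrow> 'b pmf) \<Rightarrow> bool" where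
  "dominated_pair p0 q0 = (\<lambda>(p, q).
     dominated p0 p \<and> (\<forall>x1\<in>set_pmf p. dominated (q0 x1) (q x1)))"

definition lagrangian ::
  "real \<Rightarrow> real \<Rightarrow> real \<Rightarrow> real \<Rightarrow> 'a::finite pmf \<Rightarrow> ('a \<Rightarrow> 'b::finite pmf)
   \<Rightarrow> ('a \<Rightarrow> real) \<Rightarrow> ('a \<Rightarrow> 'b \<Rightarrow> real) \<Rightarrow> 'a pmf \<times> ('a \<Rightarrow> 'b pmf) \<Rightarrow> real" where
  "lagrangian \<alpha> \<beta> c1 c2 p0 q0 U1 U2 = (\<lambda>(p, q).
     (\<Sum>x1\<in>UNIV. pmf p x1 * U1 x1)
     - \<alpha> * ((\<Sum>x1\<in>UNIV. pmf p x1 * ln (pmf p x1 / pmf p0 x1)) - c1)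
     + (\<Sum>x1\<in>UNIV. \<Sum>x2\<in>UNIV. pmf p x1 * pmf (q x1) x2 * U2 x1 x2)
     - \<beta> * ((\<Sum>x1\<in>UNIV. \<Sum>x2\<in>UNIV.
               pmf p x1 * pmf (q x1) x2 * ln (pmf (q x1) x2 / pmf (q0 x1) x2)) - c2))"

definition nested_objective ::
  "real \<Rightarrow> real \<Rightarrow> 'a::finite pmf \<Rightarrow> ('a \<Rightarrow> 'b::finite pmf)
   \<Rightarrow> ('a \<Rightarrow> real) \<Rightarrow> ('a \<Rightarrow> 'b \<Rightarrow> real) \<Rightarrow> 'a pmf \<times> ('a \<Rightarrow> 'b pmf) \<Rightarrow> real" where
  "nested_objective \<alpha> \<beta> p0 q0 U1 U2 = (\<lambda>(p, q).
     \<Sum>x1\<in>UNIV. pmf p x1 *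
       (U1 x1 - \<alpha> * ln (pmf p x1 / pmf p0 x1)
        + (\<Sum>x2\<in>UNIV. pmf (q x1) x2 *
             (U2 x1 x2 - \<beta> * ln (pmf (q x1) x2 / pmf (q0 x1) x2)))))"

definition inner_objective ::
  "real \<Rightarrow> ('a \<Rightarrow> 'b::finite pmf) \<Rightarrow> ('a \<Rightarrow> 'b \<Rightarrow> real) \<Rightarrow> 'a \<Rightarrow> 'b pmf \<Rightarrow> real" where
  "inner_objective \<beta> q0 U2 x1 r =
     (\<Sum>x2\<in>UNIV. pmf r x2 * (- \<beta> * ln (pmf r x2 / pmf (q0 x1) x2) + U2 x1 x2))"

definition Z2 ::
  "real \<Rightarrow> ('a \<Rightarrow> 'b::finite pmf) \<Rightarrow> ('a \<Rightarrow> 'b \<Rightarrow> real) \<Rightarrow> 'a \<Rightarrow> real" where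
  "Z2 \<beta> q0 U2 x1 = (\<Sum>x2\<in>UNIV. pmf (q0 x1) x2 * exp (1 / \<beta> * U2 x1 x2))"

definition outer_objective ::
  "real \<Rightarrow> real \<Rightarrow> 'a::finite pmf \<Rightarrow> ('a \<Rightarrow> 'b::finite pmf)
   \<Rightarrow> ('a \<Rightarrow> real) \<Rightarrow> ('a \<Rightarrow> 'b \<Rightarrow> real) \<Rightarrow> 'a pmf \<Rightarrow> real" where
  "outer_objective \<alpha> \<beta> p0 q0 U1 U2 p =
     (\<Sum>x1\<in>UNIV. pmf p x1 *
       (- \<alpha> * ln (pmf p x1 / pmf p0 x1) + U1 x1 + \<beta> * ln (Z2 \<beta> q0 U2 x1)))"

definition Z1 ::
  "real \<Rightarrow> real \<Rightarrow> 'a::finite pmf \<Rightarrow> ('a \<Rightarrow> 'b::finite pmf)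
   \<Rightarrow> ('a \<Rightarrow> real) \<Rightarrow> ('a \<Rightarrow> 'b \<Rightarrow> real) \<Rightarrow> real" where
  "Z1 \<alpha> \<beta> p0 q0 U1 U2 =
     (\<Sum>x1\<in>UNIV. pmf p0 x1 * exp (1 / \<alpha> * (U1 x1 + \<beta> * ln (Z2 \<beta> q0 U2 x1))))"

end

theory Submission
  imports Defs
begin

text \<open>
  All three problems are instances of the Gibbs variational principle: with
  \<open>g \<propto> p\<^sub>0 exp (V / \<gamma>)\<close> one has
  \<open>\<Sum> s (V - \<gamma> ln (s / p\<^sub>0)) = \<gamma> ln Z - \<gamma> KL(s, g)\<close>, and the relative entropy is
  nonnegative and vanishes only for \<open>s = g\<close>, because \<open>ln t \<le> t - 1\<close> with equality
  only at \<open>t = 1\<close>. In the pair problem, replacing each inner sum by its maximum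
  \<open>\<beta> ln Z\<^sub>2\<close> turns the nested objective into the outer one; this is lossless exactly
  when the conditional is optimal on the support of \<open>p\<close>.
\<close>

section \<open>The Gibbs variational principle on a finite type\<close>

definition free_energy :: "real \<Rightarrow> 'a::finite pmf \<Rightarrow> ('a \<Rightarrow> real) \<Rightarrow> 'a pmf \<Rightarrow> real" where
  "free_energy \<gamma> p0 V s = (\<Sum>x\<in>UNIV. pmf s x * (- \<gamma> * ln (pmf s x / pmf p0 x) + V x))"

text \<open>Here \<open>\<gamma>\<close> acts as a temperature. The pair \<open>free_energy\<close>,
  \<open>partition_fn\<close> serves both levels: \<open>\<beta>\<close>, \<open>q0 x1\<close>,
  \<open>U2 x1\<close> for the inner problem, and \<open>\<alpha>\<close>, \<open>p0\<close>,
  \<open>U1\<close> plus the inner value for the outer one.\<close>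

definition partition_fn :: "real \<Rightarrow> 'a::finite pmf \<Rightarrow> ('a \<Rightarrow> real) \<Rightarrow> real" where
  "partition_fn \<gamma> p0 V = (\<Sum>x\<in>UNIV. pmf p0 x * exp (1 / \<gamma> * V x))"

lemma sum_pmf_UNIV: "(\<Sum>x\<in>UNIV. pmf (p :: 'a::finite pmf) x) = 1"
  by (rule sum_pmf_eq_1) auto

lemma partition_fn_pos: "partition_fn \<gamma> p0 V > 0"
proof -
  obtain x where "x \<in> set_pmf p0"
    using set_pmf_not_empty by fastforce
  then have "pmf p0 x > 0"
    by (simp add: pmf_positive)
  then show ?thesis
    unfolding partition_fn_def by (intro sum_pos2[where i = x]) auto
qed

text \<open>For s > 0 this is the tangent bound on ln at t = g / s, scaled by s; the last assumption
  keeps t positive, away from the default value ln 0 = 0. For s = 0 the left side vanishes and only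
  the sign of g matters.\<close>

lemma mult_ln_divide_le:
  fixes s g :: real
  assumes "s \<ge> 0" "g \<ge> 0" "s > 0 \<Longrightarrow> g > 0"
  shows "s * ln (g / s) \<le> g - s"
    and "s * ln (g / s) = g - s \<longleftrightarrow> s = g"
proof -
  have "s * ln (g / s) \<le> g - s \<and> (s * ln (g / s) = g - s \<longleftrightarrow> s = g)"
  proof (cases "s = 0")
    case False
    with assms have s: "s > 0" and t: "g / s > 0" by auto
    have eq: "g - s = s * (g / s - 1)"
      using s by (simp add: field_simps)
    have "ln (g / s) \<le> g / s - 1"
      by (rule ln_le_minus_one[OF t])
    moreover have "ln (g / s) = g / s - 1 \<longleftrightarrow> s = g"
      using ln_eq_minus_one[OF t] s by auto
    ultimately show ?thesis
      unfolding eq using s by simp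
  qed (use assms in auto)
  then show "s * ln (g / s) \<le> g - s" "s * ln (g / s) = g - s \<longleftrightarrow> s = g"
    by auto
qed

text \<open>Both masses are 1, so the right sides of the pointwise bounds sum to 0. In the equality
  case the nonnegative defects sum to 0, hence each of them vanishes.\<close>

lemma relative_entropy_pmf:
  fixes s g :: "'a::finite pmf"
  assumes "dominated g s"
  shows "(\<Sum>x\<in>UNIV. pmf s x * ln (pmf g x / pmf s x)) \<le> 0"
    and "(\<Sum>x\<in>UNIV. pmf s x * ln (pmf g x / pmf s x)) = 0 \<longleftrightarrow> s = g"
proof -
  let ?t = "\<lambda>x. pmf s x * ln (pmf g x / pmf s x)"
  have pos: "pmf g x > 0" if "pmf s x > 0" for x
    using assms that by (auto simp: dominated_def pmf_positive_iff)
  have le: "?t x \<le> pmf g x - pmf s x" for x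
    using pos by (intro mult_ln_divide_le) auto
  have iff: "?t x = pmf g x - pmf s x \<longleftrightarrow> pmf s x = pmf g x" for x
    using pos by (intro mult_ln_divide_le) auto
  have sum0: "(\<Sum>x\<in>UNIV. pmf g x - pmf s x) = 0"
    by (simp add: sum_subtractf sum_pmf_UNIV)
  show "sum ?t UNIV \<le> 0"
    using sum_mono[of UNIV ?t "\<lambda>x. pmf g x - pmf s x"] le sum0 by simp
  have "sum ?t UNIV = 0 \<longleftrightarrow> (\<Sum>x\<in>UNIV. pmf g x - pmf s x - ?t x) = 0"
    using sum0 by (simp add: sum_subtractf)
  also have "\<dots> \<longleftrightarrow> (\<forall>x. pmf g x - pmf s x - ?t x = 0)"
    using le by (subst sum_nonneg_eq_0_iff) auto
  also have "\<dots> \<longleftrightarrow> (\<forall>x. pmf s x = pmf g x)"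
    using iff by (metis eq_iff_diff_eq_0)
  finally show "sum ?t UNIV = 0 \<longleftrightarrow> s = g"
    by (auto simp: pmf_eq_iff)
qed

text \<open>Recorded as a value bound with its equality case rather than as
  \<open>is_arg_max\<close>, because the pair problem has to compare inner values for different
  conditionals.\<close>

lemma gibbs_variational_principle:
  fixes p0 :: "'a::finite pmf"
  assumes "\<gamma> > 0"
  obtains g where "\<And>x. pmf g x = 1 / partition_fn \<gamma> p0 V * pmf p0 x * exp (1 / \<gamma> * V x)"
    and "dominated p0 g"
    and "\<And>s. dominated p0 s \<Longrightarrow> free_energy \<gamma> p0 V s \<le> \<gamma> * ln (partition_fn \<gamma> p0 V)"
    and "\<And>s. dominated p0 s \<Longrightarrow>
           free_energy \<gamma> p0 V s = \<gamma> * ln (partition_fn \<gamma> p0 V) \<longleftrightarrow> s = g"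
proof -
  define Z where "Z = partition_fn \<gamma> p0 V"
  have Z: "Z > 0"
    unfolding Z_def by (rule partition_fn_pos)
  define f where "f x = 1 / Z * pmf p0 x * exp (1 / \<gamma> * V x)" for x
  have f_nonneg: "f x \<ge> 0" for x
    using Z by (simp add: f_def)
  have "(\<Sum>x\<in>UNIV. f x) = 1 / Z * partition_fn \<gamma> p0 V"
    unfolding f_def partition_fn_def by (simp add: sum_distrib_left mult.assoc)
  then have sum_f: "(\<Sum>x\<in>UNIV. f x) = 1"
    using Z by (simp add: Z_def)
  define g where "g = embed_pmf f"
  have g: "pmf g x = f x" for x
    unfolding g_def
  proof (rule pmf_embed_pmf)
    show "(\<integral>\<^sup>+x. ennreal (f x) \<partial>count_space UNIV) = 1"
      using sum_f f_nonneg by (simp add: nn_integral_count_space_finite sum_ennreal)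
  qed (rule f_nonneg)
  \<comment> \<open>The factors multiplying the default are positive, so domination by
    \<open>p0\<close> and by \<open>g\<close> coincide and the entropy bound applies to every
    admissible \<open>s\<close>.\<close>
  have set_g: "set_pmf g = set_pmf p0"
    using Z by (auto simp: set_pmf_iff g f_def)
  have gap: "free_energy \<gamma> p0 V s
      = \<gamma> * ln Z + \<gamma> * (\<Sum>x\<in>UNIV. pmf s x * ln (pmf g x / pmf s x))"
    if "dominated p0 s" for s
  proof -
    \<comment> \<open>The identity already holds termwise: where \<open>s\<close> is positive,
      domination makes \<open>p0\<close> positive and the logarithms split; elsewhere both sides are
      0.\<close>
    have "pmf s x * (- \<gamma> * ln (pmf s x / pmf p0 x) + V x)
        = pmf s x * (\<gamma> * ln Z) + \<gamma> * (pmf s x * ln (pmf g x / pmf s x))" for x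
    proof (cases "pmf s x = 0")
      case False
      then have "pmf s x > 0" "pmf p0 x > 0"
        using that by (auto simp: dominated_def pmf_positive_iff set_pmf_iff less_le)
      then have ln_s: "ln (pmf s x / pmf p0 x) = ln (pmf s x) - ln (pmf p0 x)"
        and ln_g: "ln (pmf g x / pmf s x) = ln (pmf p0 x) + V x / \<gamma> - ln Z - ln (pmf s x)"
        using Z by (simp_all add: g f_def ln_mult ln_div)
      show ?thesis
        unfolding ln_s ln_g using assms by (simp add: field_simps)
    qed simp
    then show ?thesis
      by (simp add: free_energy_def sum.distrib sum_pmf_UNIV
          flip: sum_distrib_left sum_distrib_right)
  qed
  show thesis
  proof
    show "pmf g x = 1 / partition_fn \<gamma> p0 V * pmf p0 x * exp (1 / \<gamma> * V x)" for x
      by (simp add: g f_def Z_def)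
    show "dominated p0 g"
      by (simp add: dominated_def set_g)
  next
    fix s assume s: "dominated p0 s"
    then have "dominated g s"
      by (simp add: dominated_def set_g)
    note kl = relative_entropy_pmf[OF this]
    show "free_energy \<gamma> p0 V s \<le> \<gamma> * ln (partition_fn \<gamma> p0 V)"
      using gap[OF s] kl(1) assms by (simp add: Z_def mult_nonneg_nonpos)
    show "free_energy \<gamma> p0 V s = \<gamma> * ln (partition_fn \<gamma> p0 V) \<longleftrightarrow> s = g"
      using gap[OF s] kl(2) assms by (simp add: Z_def)
  qed
qed

text \<open>An attained upper bound is the maximum, so the maximisers are read off from the equality
  case.\<close>

lemma is_arg_max_iff_eq_max:
  fixes f :: "'a \<Rightarrow> 'b::linorder"
  assumes "\<And>y. P y \<Longrightarrow> f y \<le> m" and "P x0" and "f x0 = m"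
  shows "is_arg_max f P x \<longleftrightarrow> P x \<and> f x = m"
  using assms unfolding is_arg_max_def by (metis leD order.not_eq_order_implies_strict)

section \<open>The decision problem in Gibbs form\<close>

lemma inner_objective_eq_free_energy:
  "inner_objective \<beta> q0 U2 x1 = free_energy \<beta> (q0 x1) (U2 x1)"
  by (simp add: fun_eq_iff inner_objective_def free_energy_def)

lemma Z2_eq_partition_fn: "Z2 \<beta> q0 U2 x1 = partition_fn \<beta> (q0 x1) (U2 x1)"
  by (simp add: Z2_def partition_fn_def)

lemma outer_objective_eq_free_energy:
  "outer_objective \<alpha> \<beta> p0 q0 U1 U2
     = free_energy \<alpha> p0 (\<lambda>x1. U1 x1 + \<beta> * ln (Z2 \<beta> q0 U2 x1))"
  by (simp add: fun_eq_iff outer_objective_def free_energy_def algebra_simps)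

lemma Z1_eq_partition_fn:
  "Z1 \<alpha> \<beta> p0 q0 U1 U2
     = partition_fn \<alpha> p0 (\<lambda>x1. U1 x1 + \<beta> * ln (Z2 \<beta> q0 U2 x1))"
  by (simp add: Z1_def partition_fn_def)

lemma lagrangian_eq_nested_objective:
  "lagrangian \<alpha> \<beta> c1 c2 p0 q0 U1 U2 P
     = nested_objective \<alpha> \<beta> p0 q0 U1 U2 P + (\<alpha> * c1 + \<beta> * c2)"
  by (cases P) (simp add: lagrangian_def nested_objective_def algebra_simps sum.distrib
      sum_subtractf sum_distrib_left)

text \<open>Adding and subtracting \<beta> ln Z2 in each bracket decouples the unknowns:
  \<open>q\<close> enters only the subtracted sum, the expected loss from a suboptimal
  conditional.\<close>

lemma nested_objective_eq_outer_minus_gap: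
  "nested_objective \<alpha> \<beta> p0 q0 U1 U2 (p, q) = outer_objective \<alpha> \<beta> p0 q0 U1 U2 p
     - (\<Sum>x1\<in>UNIV. pmf p x1 * (\<beta> * ln (Z2 \<beta> q0 U2 x1) - inner_objective \<beta> q0 U2 x1 (q x1)))"
  unfolding nested_objective_def outer_objective_def inner_objective_def prod.case
    sum_subtractf[symmetric]
  by (intro sum.cong refl) (simp add: algebra_simps)

theorem mainTheorem1:
  fixes \<alpha> \<beta> c1 c2 :: real
    and p0 :: "'a::finite pmf" and q0 :: "'a \<Rightarrow> 'b::finite pmf"
    and U1 :: "'a \<Rightarrow> real" and U2 :: "'a \<Rightarrow> 'b \<Rightarrow> real"
  shows
    "(\<forall>P. lagrangian \<alpha> \<beta> c1 c2 p0 q0 U1 U2 P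
            = nested_objective \<alpha> \<beta> p0 q0 U1 U2 P + (\<alpha> * c1 + \<beta> * c2)
        \<and> (is_arg_max (lagrangian \<alpha> \<beta> c1 c2 p0 q0 U1 U2) (dominated_pair p0 q0) P
           \<longleftrightarrow> is_arg_max (nested_objective \<alpha> \<beta> p0 q0 U1 U2) (dominated_pair p0 q0) P))
     \<and> (\<beta> > 0 \<longrightarrow>
         (\<forall>x1. \<exists>r.
            (\<forall>x2. pmf r x2 = 1 / Z2 \<beta> q0 U2 x1 * pmf (q0 x1) x2 * exp (1 / \<beta> * U2 x1 x2))
          \<and> (\<forall>s. is_arg_max (inner_objective \<beta> q0 U2 x1) (dominated (q0 x1)) s \<longleftrightarrow> s = r)
          \<and> inner_objective \<beta> q0 U2 x1 r = \<beta> * ln (Z2 \<beta> q0 U2 x1)))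
     \<and> (\<alpha> > 0 \<and> \<beta> \<noteq> 0 \<longrightarrow>
         (\<exists>p.
            (\<forall>x1. pmf p x1 = 1 / Z1 \<alpha> \<beta> p0 q0 U1 U2 * pmf p0 x1
                     * exp (1 / \<alpha> * (U1 x1 + \<beta> * ln (Z2 \<beta> q0 U2 x1))))
          \<and> (\<forall>s. is_arg_max (outer_objective \<alpha> \<beta> p0 q0 U1 U2) (dominated p0) s \<longleftrightarrow> s = p)))
     \<and> (\<alpha> > 0 \<and> \<beta> > 0 \<longrightarrow>
         (\<exists>p q.
            (\<forall>x1. pmf p x1 = 1 / Z1 \<alpha> \<beta> p0 q0 U1 U2 * pmf p0 x1
                     * exp (1 / \<alpha> * (U1 x1 + \<beta> * ln (Z2 \<beta> q0 U2 x1))))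
          \<and> (\<forall>x1 x2. pmf (q x1) x2
                     = 1 / Z2 \<beta> q0 U2 x1 * pmf (q0 x1) x2 * exp (1 / \<beta> * U2 x1 x2))
          \<and> (\<forall>p' q'. is_arg_max (lagrangian \<alpha> \<beta> c1 c2 p0 q0 U1 U2)
                        (dominated_pair p0 q0) (p', q')
                   \<longleftrightarrow> p' = p \<and> (\<forall>x1\<in>set_pmf p. q' x1 = q x1))))"
proof -
  let ?L = "lagrangian \<alpha> \<beta> c1 c2 p0 q0 U1 U2"
  let ?N = "nested_objective \<alpha> \<beta> p0 q0 U1 U2"
  let ?O = "outer_objective \<alpha> \<beta> p0 q0 U1 U2"
  let ?I = "inner_objective \<beta> q0 U2"
  let ?Z1 = "Z1 \<alpha> \<beta> p0 q0 U1 U2"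
  let ?Z2 = "Z2 \<beta> q0 U2"
  \<comment> \<open>An additive constant preserves every strict comparison.\<close>
  have arg_max_L: "is_arg_max ?L D P \<longleftrightarrow> is_arg_max ?N D P" for D P
    by (simp add: is_arg_max_def lagrangian_eq_nested_objective)
  have inner: "\<exists>r. (\<forall>x2. pmf r x2 = 1 / ?Z2 x1 * pmf (q0 x1) x2 * exp (1 / \<beta> * U2 x1 x2))
      \<and> dominated (q0 x1) r
      \<and> (\<forall>s. dominated (q0 x1) s \<longrightarrow>
           ?I x1 s \<le> \<beta> * ln (?Z2 x1) \<and> (?I x1 s = \<beta> * ln (?Z2 x1) \<longleftrightarrow> s = r))"
    if "\<beta> > 0" for x1
    unfolding inner_objective_eq_free_energy Z2_eq_partition_fn
    by (rule gibbs_variational_principle[OF that, of "q0 x1" "U2 x1"]) blast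
  have outer: "\<exists>p. (\<forall>x1. pmf p x1 = 1 / ?Z1 * pmf p0 x1
                            * exp (1 / \<alpha> * (U1 x1 + \<beta> * ln (?Z2 x1))))
      \<and> dominated p0 p
      \<and> (\<forall>s. dominated p0 s \<longrightarrow>
           ?O s \<le> \<alpha> * ln ?Z1 \<and> (?O s = \<alpha> * ln ?Z1 \<longleftrightarrow> s = p))"
    if "\<alpha> > 0"
    unfolding outer_objective_eq_free_energy Z1_eq_partition_fn
    by (rule gibbs_variational_principle
        [OF that, of p0 "\<lambda>x1. U1 x1 + \<beta> * ln (?Z2 x1)"]) blast
  have inner_solution: "\<exists>r.
      (\<forall>x2. pmf r x2 = 1 / ?Z2 x1 * pmf (q0 x1) x2 * exp (1 / \<beta> * U2 x1 x2))
      \<and> (\<forall>s. is_arg_max (?I x1) (dominated (q0 x1)) s \<longleftrightarrow> s = r)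
      \<and> ?I x1 r = \<beta> * ln (?Z2 x1)"
    if \<beta>: "\<beta> > 0" for x1
  proof -
    obtain r where
        r: "\<forall>x2. pmf r x2 = 1 / ?Z2 x1 * pmf (q0 x1) x2 * exp (1 / \<beta> * U2 x1 x2)"
      and dom: "dominated (q0 x1) r"
      and max: "\<forall>s. dominated (q0 x1) s \<longrightarrow>
           ?I x1 s \<le> \<beta> * ln (?Z2 x1) \<and> (?I x1 s = \<beta> * ln (?Z2 x1) \<longleftrightarrow> s = r)"
      using inner[OF \<beta>] by blast
    have "is_arg_max (?I x1) (dominated (q0 x1)) s
        \<longleftrightarrow> dominated (q0 x1) s \<and> ?I x1 s = \<beta> * ln (?Z2 x1)" for s
      using dom max by (intro is_arg_max_iff_eq_max[where ?x0.0 = r]) auto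
    with r dom max show ?thesis by blast
  qed
  have outer_solution: "\<exists>p.
      (\<forall>x1. pmf p x1 = 1 / ?Z1 * pmf p0 x1 * exp (1 / \<alpha> * (U1 x1 + \<beta> * ln (?Z2 x1))))
      \<and> (\<forall>s. is_arg_max ?O (dominated p0) s \<longleftrightarrow> s = p)"
    if \<alpha>: "\<alpha> > 0"
  proof -
    obtain p where
        p: "\<forall>x1. pmf p x1 = 1 / ?Z1 * pmf p0 x1 * exp (1 / \<alpha> * (U1 x1 + \<beta> * ln (?Z2 x1)))"
      and dom: "dominated p0 p"
      and max: "\<forall>s. dominated p0 s \<longrightarrow>
           ?O s \<le> \<alpha> * ln ?Z1 \<and> (?O s = \<alpha> * ln ?Z1 \<longleftrightarrow> s = p)"
      using outer[OF \<alpha>] by blast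
    have "is_arg_max ?O (dominated p0) s \<longleftrightarrow> dominated p0 s \<and> ?O s = \<alpha> * ln ?Z1" for s
      using dom max by (intro is_arg_max_iff_eq_max[where ?x0.0 = p]) auto
    with p dom max show ?thesis by blast
  qed
  have pair_solution: "\<exists>p q.
      (\<forall>x1. pmf p x1 = 1 / ?Z1 * pmf p0 x1 * exp (1 / \<alpha> * (U1 x1 + \<beta> * ln (?Z2 x1))))
      \<and> (\<forall>x1 x2. pmf (q x1) x2 = 1 / ?Z2 x1 * pmf (q0 x1) x2 * exp (1 / \<beta> * U2 x1 x2))
      \<and> (\<forall>p' q'. is_arg_max ?L (dominated_pair p0 q0) (p', q')
           \<longleftrightarrow> p' = p \<and> (\<forall>x1\<in>set_pmf p. q' x1 = q x1))"
    if \<alpha>: "\<alpha> > 0" and \<beta>: "\<beta> > 0"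
  proof -
    obtain p where
        p: "\<forall>x1. pmf p x1 = 1 / ?Z1 * pmf p0 x1 * exp (1 / \<alpha> * (U1 x1 + \<beta> * ln (?Z2 x1)))"
      and dom_p: "dominated p0 p"
      and max_p: "\<And>s. dominated p0 s \<Longrightarrow>
           ?O s \<le> \<alpha> * ln ?Z1 \<and> (?O s = \<alpha> * ln ?Z1 \<longleftrightarrow> s = p)"
      using outer[OF \<alpha>] by blast
    \<comment> \<open>The inner maximisers, one for each \<open>x1\<close>, are collected into a
      single function by choice.\<close>
    obtain q where
        q: "\<forall>x1 x2. pmf (q x1) x2 = 1 / ?Z2 x1 * pmf (q0 x1) x2 * exp (1 / \<beta> * U2 x1 x2)"
      and dom_q: "\<And>x1. dominated (q0 x1) (q x1)"
      and max_q: "\<And>x1 s. dominated (q0 x1) s \<Longrightarrow>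
           ?I x1 s \<le> \<beta> * ln (?Z2 x1) \<and> (?I x1 s = \<beta> * ln (?Z2 x1) \<longleftrightarrow> s = q x1)"
      using inner[OF \<beta>] by metis
    have bound: "?N (p', q') \<le> \<alpha> * ln ?Z1
        \<and> (?N (p', q') = \<alpha> * ln ?Z1 \<longleftrightarrow> p' = p \<and> (\<forall>x1\<in>set_pmf p. q' x1 = q x1))"
      if "dominated_pair p0 q0 (p', q')" for p' q'
    proof -
      have dom_p': "dominated p0 p'"
        and dom_q': "\<And>x1. x1 \<in> set_pmf p' \<Longrightarrow> dominated (q0 x1) (q' x1)"
        using that by (auto simp: dominated_pair_def)
      let ?gap = "\<lambda>x1. pmf p' x1 * (\<beta> * ln (?Z2 x1) - ?I x1 (q' x1))"
      \<comment> \<open>Off the support of \<open>p'\<close> nothing is known about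
        \<open>q' x1\<close>, but the weight is 0; on the support the inner bound applies.\<close>
      have gap_nonneg: "?gap x1 \<ge> 0" for x1
        using dom_q'[of x1] max_q[of x1 "q' x1"]
        by (cases "x1 \<in> set_pmf p'") (auto simp: set_pmf_iff)
      have gap_0: "?gap x1 = 0 \<longleftrightarrow> (x1 \<in> set_pmf p' \<longrightarrow> q' x1 = q x1)" for x1
        using dom_q'[of x1] max_q[of x1 "q' x1"]
        by (cases "x1 \<in> set_pmf p'") (auto simp: set_pmf_iff)
      have "sum ?gap UNIV \<ge> 0"
        by (intro sum_nonneg gap_nonneg)
      moreover have "sum ?gap UNIV = 0 \<longleftrightarrow> (\<forall>x1\<in>set_pmf p'. q' x1 = q x1)"
        using gap_nonneg gap_0 by (subst sum_nonneg_eq_0_iff) auto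
      \<comment> \<open>The value is the outer objective minus a nonnegative loss, so equality
        forces an optimal \<open>p'\<close> and zero loss. Once \<open>p' = p\<close>, the zero-loss
        condition ranges over the support of \<open>p\<close>.\<close>
      moreover note max_p[OF dom_p']
        nested_objective_eq_outer_minus_gap[of \<alpha> \<beta> p0 q0 U1 U2 p' q']
      ultimately show ?thesis by (smt (verit))
    qed
    have dom: "dominated_pair p0 q0 (p, q)"
      using dom_p dom_q by (simp add: dominated_pair_def)
    have "is_arg_max ?N (dominated_pair p0 q0) P
        \<longleftrightarrow> dominated_pair p0 q0 P \<and> ?N P = \<alpha> * ln ?Z1" for P
    proof (rule is_arg_max_iff_eq_max)
      show "?N y \<le> \<alpha> * ln ?Z1" if "dominated_pair p0 q0 y" for y
        using bound[of "fst y" "snd y"] that by simp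
      show "?N (p, q) = \<alpha> * ln ?Z1"
        using bound[OF dom] by simp
    qed (rule dom)
    \<comment> \<open>For the converse, a conditional that is arbitrary off the support of
      \<open>p\<close> must still be admissible.\<close>
    moreover have "dominated_pair p0 q0 (p, q')" if "\<forall>x1\<in>set_pmf p. q' x1 = q x1" for q'
      using that dom_p dom_q by (simp add: dominated_pair_def)
    ultimately have "is_arg_max ?L (dominated_pair p0 q0) (p', q')
        \<longleftrightarrow> p' = p \<and> (\<forall>x1\<in>set_pmf p. q' x1 = q x1)" for p' q'
      unfolding arg_max_L using bound by blast
    with p q show ?thesis by blast
  qed
  show ?thesis
    by (intro conjI impI allI lagrangian_eq_nested_objective arg_max_L
        inner_solution outer_solution pair_solution) simp_all
qed

end
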